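(* Let $R$ be an integral domain, let $P,Q\in R$ with $Q\in R^{\times}$, let $f(t)=t^2-Pt+Q$ with roots $\theta_1,\theta_2$ in an algebraic closure of the fraction field of $R$, and assume $d:=P^2-4Q\neq 0$. Let $\mathscr{S}(f,R)^{\times}$ be the set of sequences $(w_n)_{n\in\mathbb Z}$ of elements of $R$ satisfying $w_{n+2}-Pw_{n+1}+Qw_n=0$ for all $n\in\mathbb Z$ and $\Lambda(w_1,w_0):=w_1^2-Pw_0w_1+Qw_0^2\in R^{\times}$, equipped with Laxton's product: for ${\bf w}=(w_n)$, ${\bf v}=(v_n)$ write $w_n=\frac{A\theta_1^n-B\theta_2^n}{\theta_1-\theta_2}$, $v_n=\frac{C\theta_1^n-D'\theta_2^n}{\theta_1-\theta_2}$ with $A=w_1-w_0\theta_2$, $B=w_1-w_0\theta_1$, $C=v_1-v_0\theta_2$, $D'=v_1-v_0\theta_1$, and set ${\bf w}\times{\bf v}=(u_n)$ with $u_n=\frac{AC\theta_1^n-BD'\theta_2^n}{\theta_1-\theta_2}$. Let $V_f(R)^{\times}=\{(a_1,a_0)^T\in R^2:\Lambda(a_1,a_0)\in R^{\times}\}$ and $\mathcal O_R=R[t]/(f(t))$. Then the maps $$\mathscr{S}(f,R)^{\times}\xrightarrow{\phi_R}V_f(R)^{\times}\xrightarrow{\varphi_R}\mathcal O_R^{\times},\qquad (w_n)\mapsto (w_1,w_0)^T\mapsto w_1-w_0t \bmod f(t),$$ are bijections, and Laxton's group structure on $\mathscr{S}(f,R)^{\times}$ coincides with the one transported from the multiplicative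 group $\mathcal O_R^{\times}$ via these maps. Moreover, with $\mathcal B=\begin{pmatrix}P&-Q\\1&0\end{pmatrix}\in \mathrm{GL}_2(R)$, these group isomorphisms are compatible with the following actions of $\langle\mathcal B\rangle$: (i) on $\mathscr{S}(f,R)^{\times}$, $\mathcal B^{\nu}.(w_n)=(v_n)$ with $v_n=w_{n+\nu}$ for all $n$; (ii) on $V_f(R)^{\times}$, $\mathcal B^{\nu}.(w_1,w_0)^T=\mathcal B^{\nu}(w_1,w_0)^T$ (matrix product); (iii) on $\mathcal O_R^{\times}$, $\mathcal B^{\nu}.(w_1-w_0t)=(P-t)^{\nu}(w_1-w_0t)$, for all $\nu\in\mathbb Z$.
   Context: Laxton's product is defined via division by $\theta_1-\theta_2$; in terms of initial terms it reads $u_1=w_1v_1-Qw_0v_0$, $u_0=w_0v_1+w_1v_0-Pw_0v_0$. *)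

theory Defs
  imports
    "HOL-Algebra.Algebra"
    "HOL-Algebra.Algebraic_Closure_Type"
    "HOL-Analysis.Cartesian_Space"
begin

unbundle no fps_syntax

definition emb :: "'a::idom \<Rightarrow> 'a fract alg_closure" where
  "emb x = to_ac (to_fract x)"

definition char_poly :: "'a::idom \<Rightarrow> 'a \<Rightarrow> 'a poly" where
  "char_poly P Q = [:Q, - P, 1:]"

definition Lam :: "'a::idom \<Rightarrow> 'a \<Rightarrow> 'a \<Rightarrow> 'a \<Rightarrow> 'a" where
  "Lam P Q x1 x0 = x1^2 - P * x0 * x1 + Q * x0^2"

definition seq_units :: "'a::idom \<Rightarrow> 'a \<Rightarrow> (int \<Rightarrow> 'a) set" where
  "seq_units P Q =
     {w. (\<forall>n. w (n + 2) - P * w (n + 1) + Q * w n = 0) \<and> Lam P Q (w 1) (w 0) dvd 1}"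

text \<open>For the sequence \<open>w\<close>, the coefficient \<open>A\<close> is \<open>binet_coeff \<theta>\<^sub>2 w\<close> and \<open>B\<close> is
  \<open>binet_coeff \<theta>\<^sub>1 w\<close>; note the swap of the roots.\<close>

definition binet_coeff :: "'a::idom fract alg_closure \<Rightarrow> (int \<Rightarrow> 'a) \<Rightarrow> 'a fract alg_closure" where
  "binet_coeff \<theta> w = emb (w 1) - emb (w 0) * \<theta>"

definition binet :: "'b::field \<Rightarrow> 'b \<Rightarrow> 'b \<Rightarrow> 'b \<Rightarrow> int \<Rightarrow> 'b" where
  "binet \<theta>1 \<theta>2 A B n = (A * \<theta>1 powi n - B * \<theta>2 powi n) / (\<theta>1 - \<theta>2)"

definition laxton_mult ::
  "'a::idom fract alg_closure \<Rightarrow> 'a fract alg_closure \<Rightarrow> (int \<Rightarrow> 'a) \<Rightarrow> (int \<Rightarrow> 'a) \<Rightarrow> (int \<Rightarrow> 'a)" where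
  "laxton_mult \<theta>1 \<theta>2 w v =
     (THE u. \<forall>n. emb (u n) =
        binet \<theta>1 \<theta>2 (binet_coeff \<theta>2 w * binet_coeff \<theta>2 v) (binet_coeff \<theta>1 w * binet_coeff \<theta>1 v) n)"

text \<open>The neutral element is the sequence with \<open>A = B = 1\<close>, i.e. the Lucas sequence
  starting with \<open>w\<^sub>0 = 0\<close>, \<open>w\<^sub>1 = 1\<close>.\<close>

definition laxton_one ::
  "'a::idom fract alg_closure \<Rightarrow> 'a fract alg_closure \<Rightarrow> int \<Rightarrow> 'a" where
  "laxton_one \<theta>1 \<theta>2 = (THE u. \<forall>n. emb (u n) = binet \<theta>1 \<theta>2 1 1 n)"

definition laxton_group ::
  "'a::idom \<Rightarrow> 'a \<Rightarrow> 'a fract alg_closure \<Rightarrow> 'a fract alg_closure \<Rightarrow> (int \<Rightarrow> 'a) monoid" where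
  "laxton_group P Q \<theta>1 \<theta>2 =
     \<lparr>carrier = seq_units P Q, monoid.mult = laxton_mult \<theta>1 \<theta>2, one = laxton_one \<theta>1 \<theta>2\<rparr>"

text \<open>A column \<open>(a\<^sub>1, a\<^sub>0)\<^sup>T\<close> is the vector \<open>a\<close> with \<open>a $ 1 = a\<^sub>1\<close> and \<open>a $ 2 = a\<^sub>0\<close>.\<close>

definition vec_units :: "'a::idom \<Rightarrow> 'a \<Rightarrow> ('a ^ 2) set" where
  "vec_units P Q = {a. Lam P Q (a $ 1) (a $ 2) dvd 1}"

definition quot_ideal :: "'a::idom \<Rightarrow> 'a \<Rightarrow> 'a poly set" where
  "quot_ideal P Q = PIdl\<^bsub>ring_of_type_algebra\<^esub> (char_poly P Q)"

definition quot_ring :: "'a::idom \<Rightarrow> 'a \<Rightarrow> 'a poly set ring" where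
  "quot_ring P Q = ring_of_type_algebra Quot quot_ideal P Q"

definition quot_class :: "'a::idom \<Rightarrow> 'a \<Rightarrow> 'a poly \<Rightarrow> 'a poly set" where
  "quot_class P Q p = quot_ideal P Q +>\<^bsub>ring_of_type_algebra\<^esub> p"

definition quot_units :: "'a::idom \<Rightarrow> 'a \<Rightarrow> 'a poly set monoid" where
  "quot_units P Q = units_of (quot_ring P Q)"

definition seq_to_vec :: "(int \<Rightarrow> 'a::idom) \<Rightarrow> 'a ^ 2" where
  "seq_to_vec w = vector [w 1, w 0]"

definition vec_to_quot :: "'a::idom \<Rightarrow> 'a \<Rightarrow> 'a ^ 2 \<Rightarrow> 'a poly set" where
  "vec_to_quot P Q a = quot_class P Q [:a $ 1, - (a $ 2):]"

text \<open>The structure pulled back to \<open>S\<close> along a bijection \<open>h\<close> from \<open>S\<close> onto the carrier of \<open>G\<close>.\<close>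

definition transport :: "'b set \<Rightarrow> ('b \<Rightarrow> 'c) \<Rightarrow> 'c monoid \<Rightarrow> 'b monoid" where
  "transport S h G =
     \<lparr>carrier = S,
      monoid.mult = (\<lambda>x y. inv_into S h (h x \<otimes>\<^bsub>G\<^esub> h y)),
      one = inv_into S h \<one>\<^bsub>G\<^esub>\<rparr>"

definition vec_group :: "'a::idom \<Rightarrow> 'a \<Rightarrow> ('a ^ 2) monoid" where
  "vec_group P Q = transport (vec_units P Q) (vec_to_quot P Q) (quot_units P Q)"

definition GL2 :: "('a::idom ^ 2 ^ 2) monoid" where
  "GL2 = \<lparr>carrier = {M. invertible M}, monoid.mult = (**), one = mat 1\<rparr>"

definition Bmat :: "'a::idom \<Rightarrow> 'a \<Rightarrow> 'a ^ 2 ^ 2" where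
  "Bmat P Q = vector [vector [P, - Q], vector [1, 0]]"

definition Bgroup :: "'a::idom \<Rightarrow> 'a \<Rightarrow> ('a ^ 2 ^ 2) monoid" where
  "Bgroup P Q = subgroup_generated GL2 {Bmat P Q}"

end

theory Submission
  imports Defs
begin

text \<open>
  Modulo \<open>f\<close> every polynomial has a unique representative \<open>a\<^sub>1 - a\<^sub>0 t\<close>, and \<open>\<Lambda>(a\<^sub>1, a\<^sub>0)\<close>
  is its norm, so the representative is a unit exactly when \<open>\<Lambda>(a\<^sub>1, a\<^sub>0)\<close> is one. Evaluating at
  \<open>t = \<theta>\<^sub>2\<close> and \<open>t = \<theta>\<^sub>1\<close> turns it into the Binet coefficients \<open>A\<close> and \<open>B\<close>; hence Laxton's product,
  which multiplies these coefficients, is multiplication modulo \<open>f\<close>. Shifting a sequence applies the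
  companion matrix to its initial terms, and in coordinates this matrix is multiplication by
  \<open>P - t\<close>, an element of norm \<open>Q\<close>.
\<close>

no_notation fps_nth (infixl \<open>$\<close> 75)

section \<open>Group actions and transport of structure\<close>

text \<open>\<open>group_action\<close> is a homomorphism into \<open>BijGroup E\<close>, whose
  elements are extensional bijections; hence the restriction to \<open>E\<close>. Each map is
  bijective because the inverse group element undoes it.\<close>

lemma group_actionI:
  assumes "group G"
    and closed: "\<And>g x. g \<in> carrier G \<Longrightarrow> x \<in> E \<Longrightarrow> \<phi> g x \<in> E"
    and one: "\<And>x. x \<in> E \<Longrightarrow> \<phi> \<one>\<^bsub>G\<^esub> x = x"
    and mult: "\<And>g h x. g \<in> carrier G \<Longrightarrow> h \<in> carrier G \<Longrightarrow> x \<in> E \<Longrightarrow>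
      \<phi> (g \<otimes>\<^bsub>G\<^esub> h) x = \<phi> g (\<phi> h x)"
  shows "group_action G E (\<lambda>g. \<lambda>x\<in>E. \<phi> g x)"
proof -
  interpret group G by fact
  have inverse: "\<phi> (inv\<^bsub>G\<^esub> g) (\<phi> g x) = x" "\<phi> g (\<phi> (inv\<^bsub>G\<^esub> g) x) = x"
    if "g \<in> carrier G" "x \<in> E" for g x
    using mult[of "inv\<^bsub>G\<^esub> g" g x] mult[of g "inv\<^bsub>G\<^esub> g" x] one that by simp_all
  have "bij_betw (\<lambda>x\<in>E. \<phi> g x) E E" if "g \<in> carrier G" for g
    by (rule bij_betw_byWitness[where f' = "\<phi> (inv\<^bsub>G\<^esub> g)"])
      (use that closed inverse in auto)
  then have "(\<lambda>x\<in>E. \<phi> g x) \<in> carrier (BijGroup E)" if "g \<in> carrier G" for g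
    using that by (simp add: BijGroup_def Bij_def)
  moreover have "(\<lambda>x\<in>E. \<phi> (g \<otimes>\<^bsub>G\<^esub> h) x) = compose E (\<lambda>x\<in>E. \<phi> g x) (\<lambda>x\<in>E. \<phi> h x)"
    if "g \<in> carrier G" "h \<in> carrier G" for g h
    using that closed mult by (auto simp: compose_def fun_eq_iff)
  ultimately have "(\<lambda>g. \<lambda>x\<in>E. \<phi> g x) \<in> hom G (BijGroup E)"
    by (auto simp: hom_def BijGroup_def)
  then show ?thesis
    by (simp add: group_action_def group_hom_def group_hom_axioms_def group_BijGroup \<open>group G\<close>)
qed

text \<open>Conjugation by \<open>h\<close>: in a composite the inner \<open>h\<close> and
  \<open>inv_into F h\<close> cancel, since the action keeps \<open>h x\<close> inside
  \<open>E\<close>.\<close>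

lemma group_action_transport:
  assumes "group_action G E \<phi>" and "bij_betw h F E"
  shows "group_action G F (\<lambda>g. \<lambda>x\<in>F. inv_into F h (\<phi> g (h x)))"
proof (rule group_actionI)
  interpret group_action G E \<phi> by fact
  show "group G"
    by (rule group_hom.axioms(1)[OF group_hom])
  have hE: "h x \<in> E" if "x \<in> F" for x
    using assms(2) that by (rule bij_betw_apply)
  show "inv_into F h (\<phi> g (h x)) \<in> F" if "g \<in> carrier G" "x \<in> F" for g x
    using bij_betw_apply[OF bij_betw_inv_into[OF assms(2)]] element_image[OF that(1) hE[OF that(2)]]
    by blast
  show "inv_into F h (\<phi> \<one>\<^bsub>G\<^esub> (h x)) = x" if "x \<in> F" for x
    using that hE id_eq_one bij_betw_inv_into_left[OF assms(2)] by (metis restrict_apply')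
  show "inv_into F h (\<phi> (g1 \<otimes>\<^bsub>G\<^esub> g2) (h x)) =
      inv_into F h (\<phi> g1 (h (inv_into F h (\<phi> g2 (h x)))))"
    if "g1 \<in> carrier G" "g2 \<in> carrier G" "x \<in> F" for g1 g2 x
    using composition_rule[OF hE[OF that(3)] that(1,2)]
      element_image[OF that(2) hE[OF that(3)] refl] bij_betw_inv_into_right[OF assms(2)]
    by simp
qed

text \<open>Each equation in \<open>G\<close> is checked after applying the injective
  \<open>h\<close>; an inverse of \<open>x\<close> is the preimage of the inverse of
  \<open>h x\<close>.\<close>

lemma group_if_bij_hom:
  assumes "group H" and bij: "bij_betw h (carrier G) (carrier H)"
    and closed: "\<And>x y. x \<in> carrier G \<Longrightarrow> y \<in> carrier G \<Longrightarrow> x \<otimes>\<^bsub>G\<^esub> y \<in> carrier G"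
    and hom: "\<And>x y. x \<in> carrier G \<Longrightarrow> y \<in> carrier G \<Longrightarrow>
      h (x \<otimes>\<^bsub>G\<^esub> y) = h x \<otimes>\<^bsub>H\<^esub> h y"
    and one: "\<one>\<^bsub>G\<^esub> \<in> carrier G" "h \<one>\<^bsub>G\<^esub> = \<one>\<^bsub>H\<^esub>"
  shows "group G"
proof (rule groupI)
  interpret H: group H by fact
  have inj: "x = y" if "h x = h y" "x \<in> carrier G" "y \<in> carrier G" for x y
    using bij that by (auto simp: bij_betw_def inj_on_def)
  have hH: "h x \<in> carrier H" if "x \<in> carrier G" for x
    using bij that by (rule bij_betw_apply)
  show "x \<otimes>\<^bsub>G\<^esub> y \<otimes>\<^bsub>G\<^esub> z = x \<otimes>\<^bsub>G\<^esub> (y \<otimes>\<^bsub>G\<^esub> z)"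
    if "x \<in> carrier G" "y \<in> carrier G" "z \<in> carrier G" for x y z
    by (rule inj) (use that closed hom hH H.m_assoc in auto)
  show "\<one>\<^bsub>G\<^esub> \<otimes>\<^bsub>G\<^esub> x = x" if "x \<in> carrier G" for x
    by (rule inj) (use that closed hom hH one in auto)
  show "\<exists>y\<in>carrier G. y \<otimes>\<^bsub>G\<^esub> x = \<one>\<^bsub>G\<^esub>" if x: "x \<in> carrier G" for x
  proof -
    obtain y where "y \<in> carrier G" "h y = inv\<^bsub>H\<^esub> h x"
      using bij H.inv_closed[OF hH[OF x]] by (metis bij_betw_def imageE)
    then show ?thesis
      by (intro bexI[of _ y] inj) (use x closed hom hH one in auto)
  qed
qed (use closed one in auto)

section \<open>The companion matrix\<close>

lemma group_GL2: "group (GL2 :: ('a::idom ^ 2 ^ 2) monoid)"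
proof (rule groupI)
  show "\<exists>B\<in>carrier GL2. B \<otimes>\<^bsub>GL2\<^esub> A = \<one>\<^bsub>GL2\<^esub>" if "A \<in> carrier GL2" for A :: "'a ^ 2 ^ 2"
    using that by (auto simp: GL2_def invertible_def)
  show "\<one>\<^bsub>GL2\<^esub> \<in> carrier (GL2 :: ('a ^ 2 ^ 2) monoid)"
    by (auto simp: GL2_def invertible_def intro!: exI[of _ "mat 1"])
qed (auto simp: GL2_def invertible_mult matrix_mul_assoc)

lemma Bmat_mult_vec:
  "Bmat P Q *v a = vector [P * a $ 1 - Q * a $ 2, a $ 1]"
  by (simp add: vec_eq_iff forall_2 matrix_vector_mult_def sum_2 Bmat_def)

lemma Bmat_in_GL2:
  assumes "Q dvd (1 :: 'a::idom)"
  shows "Bmat P Q \<in> carrier GL2"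
proof -
  obtain q where "1 = Q * q"
    using assms by (auto elim: dvdE)
  then have "Q * q = 1" "q * Q = 1" "Q * (q * P) = P"
    by (simp_all add: mult.commute)
  \<comment> \<open>The inverse is the adjugate of \<open>Bmat P Q\<close> times \<open>q\<close>,
    because the determinant is \<open>Q\<close>.\<close>
  then have "Bmat P Q ** vector [vector [0, 1], vector [- q, q * P]] = mat 1"
    "vector [vector [0, 1], vector [- q, q * P]] ** Bmat P Q = mat 1"
    by (simp_all add: vec_eq_iff forall_2 matrix_matrix_mult_def sum_2 Bmat_def mat_def mult.commute)
  then show ?thesis
    by (auto simp: GL2_def invertible_def)
qed

lemma Bmat_int_pow_add_1:
  assumes "Q dvd (1 :: 'a::idom)"
  shows "(Bmat P Q [^]\<^bsub>GL2\<^esub> (n + 1 :: int)) *v a = Bmat P Q *v ((Bmat P Q [^]\<^bsub>GL2\<^esub> n) *v a)"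
proof -
  have "Bmat P Q [^]\<^bsub>GL2\<^esub> (1 + n) = Bmat P Q \<otimes>\<^bsub>GL2\<^esub> (Bmat P Q [^]\<^bsub>GL2\<^esub> n)"
    using group.int_pow_mult[OF group_GL2 Bmat_in_GL2[OF assms], of P 1 n]
      group.int_pow_1[OF group_GL2 Bmat_in_GL2[OF assms]] by simp
  then show ?thesis
    by (simp add: GL2_def add.commute matrix_vector_mul_assoc)
qed

lemma GL2_one_mult_vec: "\<one>\<^bsub>GL2\<^esub> *v a = a"
  by (simp add: GL2_def)

text \<open>The second coordinate of the product gives back \<open>a $ 1\<close>; then
  \<open>Q * a $ 2\<close> is determined and \<open>Q\<close> cancels in the domain.\<close>

lemma Bmat_mult_vec_inj:
  assumes "Q dvd (1 :: 'a::idom)" and "Bmat P Q *v a = Bmat P Q *v b"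
  shows "a = b"
proof -
  have "Q \<noteq> 0" using assms(1) by auto
  with assms(2) show ?thesis
    by (auto simp: Bmat_mult_vec vec_eq_iff forall_2)
qed

lemma Bmat_orbit_eq_int_pow:
  assumes "Q dvd (1 :: 'a::idom)" and step: "\<And>n. s (n + 1) = Bmat P Q *v s n"
  shows "s n = (Bmat P Q [^]\<^bsub>GL2\<^esub> (n :: int)) *v s 0"
proof (induction n rule: int_induct[where k = 0])
  case base
  show ?case by (simp add: GL2_one_mult_vec)
next
  case (step1 i)
  then show ?case by (simp add: step Bmat_int_pow_add_1[OF assms(1)])
next
  case (step2 i)
  \<comment> \<open>Downward step: both sides equal the vector at \<open>i\<close>, and the factor
    \<open>Bmat P Q\<close> is then cancelled.\<close>
  have "Bmat P Q *v s (i - 1) = Bmat P Q *v ((Bmat P Q [^]\<^bsub>GL2\<^esub> (i - 1)) *v s 0)"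
    using step2 step[of "i - 1"] Bmat_int_pow_add_1[OF assms(1), of P "i - 1" "s 0"] by simp
  then show ?case by (rule Bmat_mult_vec_inj[OF assms(1)])
qed

lemma carrier_Bgroup:
  assumes "Q dvd (1 :: 'a::idom)"
  shows "carrier (Bgroup P Q) = range (\<lambda>n::int. Bmat P Q [^]\<^bsub>GL2\<^esub> n)"
  unfolding Bgroup_def
  by (rule group.carrier_subgroup_generated_by_singleton[OF group_GL2 Bmat_in_GL2[OF assms]])

section \<open>Units in coordinates\<close>

text \<open>These are the coordinates of \<open>(a1 - a0 t) (b1 - b0 t)\<close> after reduction by
  \<open>t^2 = P t - Q\<close>, and also the initial terms of Laxton's product.\<close>

definition vec_mult :: "'a::idom \<Rightarrow> 'a \<Rightarrow> 'a ^ 2 \<Rightarrow> 'a ^ 2 \<Rightarrow> 'a ^ 2" where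
  "vec_mult P Q a b =
     vector [a $ 1 * b $ 1 - Q * a $ 2 * b $ 2, a $ 2 * b $ 1 + a $ 1 * b $ 2 - P * a $ 2 * b $ 2]"

text \<open>A polynomial identity expressing that the norm form is multiplicative.\<close>

lemma Lam_vec_mult:
  "Lam P Q (vec_mult P Q a b $ 1) (vec_mult P Q a b $ 2) =
     Lam P Q (a $ 1) (a $ 2) * Lam P Q (b $ 1) (b $ 2)"
  by (simp add: Lam_def vec_mult_def algebra_simps power2_eq_square)

lemma vec_mult_closed:
  assumes "a \<in> vec_units P Q" "b \<in> vec_units P Q"
  shows "vec_mult P Q a b \<in> vec_units P Q"
  using mult_dvd_mono[of _ 1 _ 1] assms by (simp add: vec_units_def Lam_vec_mult)

lemma one_in_vec_units: "vector [1, 0] \<in> vec_units P Q"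
  by (simp add: vec_units_def Lam_def)

text \<open>The matrix scales \<Lambda> by its determinant, the unit \<open>Q\<close>. The
  equivalence serves both directions of integer induction.\<close>

lemma Bmat_mult_vec_units_iff:
  assumes "Q dvd 1"
  shows "Bmat P Q *v a \<in> vec_units P Q \<longleftrightarrow> a \<in> vec_units P Q"
proof -
  have "Lam P Q (P * a $ 1 - Q * a $ 2) (a $ 1) = Q * Lam P Q (a $ 1) (a $ 2)"
    by (simp add: Lam_def algebra_simps power2_eq_square)
  moreover have "Q * x dvd 1 \<longleftrightarrow> x dvd 1" for x
    using assms dvd_mult_right[of Q x 1] mult_dvd_mono[of Q 1 x 1] by auto
  ultimately show ?thesis
    by (simp add: vec_units_def Bmat_mult_vec)
qed

lemma Bmat_int_pow_mult_vec_units: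
  assumes "Q dvd 1" and "a \<in> vec_units P Q"
  shows "(Bmat P Q [^]\<^bsub>GL2\<^esub> (n :: int)) *v a \<in> vec_units P Q"
proof (induction n rule: int_induct[where k = 0])
  case base
  show ?case using assms(2) by (simp add: GL2_one_mult_vec)
next
  case (step1 i)
  then show ?case by (simp add: Bmat_int_pow_add_1 Bmat_mult_vec_units_iff assms(1))
next
  case (step2 i)
  then show ?case
    using Bmat_int_pow_add_1[OF assms(1), of P "i - 1" a] by (simp add: Bmat_mult_vec_units_iff assms(1))
qed

lemma group_action_vec_units:
  assumes "Q dvd 1"
  shows "group_action (Bgroup P Q) (vec_units P Q) (\<lambda>g. \<lambda>a\<in>vec_units P Q. g *v a)"
proof (rule group_actionI)
  show "group (Bgroup P Q)"
    unfolding Bgroup_def by (rule group.group_subgroup_generated[OF group_GL2])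
  show "g *v a \<in> vec_units P Q" if "g \<in> carrier (Bgroup P Q)" "a \<in> vec_units P Q" for g a
    using that Bmat_int_pow_mult_vec_units[OF assms] by (auto simp: carrier_Bgroup[OF assms])
qed (simp_all add: Bgroup_def subgroup_generated_def GL2_def matrix_vector_mul_assoc)

section \<open>Recurrent sequences\<close>

text \<open>Separated from the unit condition so that it also applies over the algebraic closure, to
  the Binet expressions.\<close>

definition recurrent :: "'a::idom \<Rightarrow> 'a \<Rightarrow> (int \<Rightarrow> 'a) \<Rightarrow> bool" where
  "recurrent P Q w \<longleftrightarrow> (\<forall>n. w (n + 2) - P * w (n + 1) + Q * w n = 0)"

lemma recurrent_iff: "recurrent P Q w \<longleftrightarrow> (\<forall>n. w (n + 2) = P * w (n + 1) - Q * w n)"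
  by (simp add: recurrent_def diff_add_eq eq_diff_eq)

lemma seq_units_iff: "w \<in> seq_units P Q \<longleftrightarrow> recurrent P Q w \<and> seq_to_vec w \<in> vec_units P Q"
  by (simp add: seq_units_def recurrent_def vec_units_def seq_to_vec_def)

lemma recurrent_eqI:
  assumes "recurrent P Q w" "recurrent P Q v" and "Q \<noteq> 0" and init: "w 0 = v 0" "w 1 = v 1"
  shows "w = v"
proof -
  have w: "w (n + 2) = P * w (n + 1) - Q * w n" for n
    using assms(1) by (simp add: recurrent_iff)
  have v: "v (n + 2) = P * v (n + 1) - Q * v n" for n
    using assms(2) by (simp add: recurrent_iff)
  have "w n = v n \<and> w (n + 1) = v (n + 1)" for n
  proof (induction n rule: int_induct[where k = 0])
    case base
    show ?case using init by simp
  next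
    case (step1 i)
    then show ?case using w[of i] v[of i] by (simp add: add.assoc)
  next
    case (step2 i)
    \<comment> \<open>The recurrence at \<open>i - 1\<close> expresses \<open>Q * w (i - 1)\<close>
      by the two later terms; cancelling \<open>Q\<close> runs it backwards.\<close>
    then show ?case using w[of "i - 1"] v[of "i - 1"] \<open>Q \<noteq> 0\<close>
      by (simp add: add.commute)
  qed
  then show ?thesis by auto
qed

lemma recurrent_shift_add_1:
  assumes "recurrent P Q w"
  shows "seq_to_vec (\<lambda>k. w (k + (n + 1))) = Bmat P Q *v seq_to_vec (\<lambda>k. w (k + n))"
proof -
  have "w (n + 2) = P * w (n + 1) - Q * w n"
    using assms by (simp add: recurrent_iff)
  then show ?thesis
    by (simp add: Bmat_mult_vec seq_to_vec_def add.commute)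
qed

text \<open>The windows \<open>(w (n + 1), w n)\<close> form an orbit of the companion matrix that
  starts at \<open>seq_to_vec w\<close>.\<close>

lemma seq_to_vec_shift:
  assumes "Q dvd 1" and "recurrent P Q w"
  shows "seq_to_vec (\<lambda>k. w (k + n)) = (Bmat P Q [^]\<^bsub>GL2\<^esub> n) *v seq_to_vec w"
  using Bmat_orbit_eq_int_pow[of Q "\<lambda>n. seq_to_vec (\<lambda>k. w (k + n))" P n] assms
    recurrent_shift_add_1[OF assms(2)] by simp

lemma seq_units_shift:
  assumes "Q dvd 1" and "w \<in> seq_units P Q"
  shows "(\<lambda>k. w (k + n)) \<in> seq_units P Q"
proof -
  have "recurrent P Q (\<lambda>k. w (k + n))"
    using assms(2) unfolding seq_units_iff recurrent_def by (metis add.commute add.left_commute)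
  then show ?thesis
    using assms seq_to_vec_shift[of Q P w n] by (simp add: seq_units_iff Bmat_int_pow_mult_vec_units)
qed

text \<open>The sequence is read off as the second coordinate of the matrix orbit of
  \<open>a\<close>. Since \<open>Q\<close> is a unit, negative powers of the matrix have entries in
  the ring too.\<close>

lemma recurrent_extension:
  assumes "Q dvd (1 :: 'a::idom)"
  obtains w where "recurrent P Q w" "seq_to_vec w = a"
proof
  let ?s = "\<lambda>n::int. (Bmat P Q [^]\<^bsub>GL2\<^esub> n) *v a"
  have s: "?s (n + 1) = vector [P * ?s n $ 1 - Q * ?s n $ 2, ?s n $ 1]" for n
    by (simp add: Bmat_int_pow_add_1[OF assms] Bmat_mult_vec)
  have "?s (n + 2) $ 2 = P * ?s (n + 1) $ 2 - Q * ?s n $ 2" for n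
    using s[of "n + 1"] s[of n] by (simp add: add.assoc)
  then show "recurrent P Q (\<lambda>n. ?s n $ 2)"
    by (simp add: recurrent_iff)
  show "seq_to_vec (\<lambda>n. ?s n $ 2) = a"
    using s[of 0] by (simp add: seq_to_vec_def vec_eq_iff forall_2 GL2_one_mult_vec)
qed

lemma bij_betw_seq_to_vec:
  assumes "Q dvd 1"
  shows "bij_betw seq_to_vec (seq_units P Q) (vec_units P Q)"
proof (rule bij_betw_imageI)
  have "Q \<noteq> 0" using assms by auto
  then show "inj_on seq_to_vec (seq_units P Q)"
    by (auto simp: inj_on_def seq_units_iff seq_to_vec_def vec_eq_iff forall_2 intro!: recurrent_eqI)
  show "seq_to_vec ` seq_units P Q = vec_units P Q"
  proof (intro equalityI subsetI)
    fix a assume a: "a \<in> vec_units P Q"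
    obtain w where "recurrent P Q w" "seq_to_vec w = a"
      using recurrent_extension[OF assms] .
    with a show "a \<in> seq_to_vec ` seq_units P Q"
      by (auto simp: seq_units_iff)
  qed (auto simp: seq_units_iff)
qed

section \<open>The quotient ring\<close>

lemma quot_ideal_eq: "quot_ideal P Q = {p. char_poly P Q dvd p}"
  by (auto simp: quot_ideal_def cgenideal_def ring_of_type_algebra_def dvd_def mult.commute)

lemma ideal_quot_ideal: "ideal (quot_ideal P Q) ring_of_type_algebra"
  unfolding quot_ideal_def
  by (rule cring.cgenideal_ideal[OF cring_from_type_algebra]) (simp add: ring_of_type_algebra_def)

lemma cring_quot_ring: "cring (quot_ring P Q)"
  unfolding quot_ring_def
  by (rule ideal.quotient_is_cring[OF ideal_quot_ideal cring_from_type_algebra])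

lemma group_quot_units: "group (quot_units P Q)"
  unfolding quot_units_def
  by (rule monoid.units_group) (rule ring.is_monoid[OF cring.axioms(1)[OF cring_quot_ring]])

lemma quot_class_eq_iff: "quot_class P Q p = quot_class P Q q \<longleftrightarrow> char_poly P Q dvd p - q"
proof -
  interpret R: cring "ring_of_type_algebra :: 'a poly ring"
    by (rule cring_from_type_algebra)
  \<comment> \<open>The coset criterion uses subtraction derived from the ring structure; it is
    first identified with subtraction of polynomials.\<close>
  have "q \<oplus>\<^bsub>ring_of_type_algebra\<^esub> (- q) = \<zero>\<^bsub>ring_of_type_algebra\<^esub>"
    by (simp add: ring_of_type_algebra_def)
  then have "\<ominus>\<^bsub>ring_of_type_algebra\<^esub> q = - q"
    by (intro R.minus_equality) (simp_all add: ring_of_type_algebra_def)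
  then have "p \<ominus>\<^bsub>ring_of_type_algebra\<^esub> q = p - q"
    by (simp add: a_minus_def ring_of_type_algebra_def)
  then show ?thesis
    using R.quotient_eq_iff_same_a_r_cos[OF ideal_quot_ideal, of p q P Q]
    by (simp add: quot_class_def quot_ideal_eq ring_of_type_algebra_def)
qed

lemma quot_class_ring_hom: "quot_class P Q \<in> ring_hom ring_of_type_algebra (quot_ring P Q)"
  unfolding quot_class_def quot_ring_def by (rule ideal.rcos_ring_hom[OF ideal_quot_ideal])

lemma quot_class_mult: "quot_class P Q p \<otimes>\<^bsub>quot_ring P Q\<^esub> quot_class P Q q = quot_class P Q (p * q)"
  using ring_hom_mult[OF quot_class_ring_hom, of p q P Q] by (simp add: ring_of_type_algebra_def)

lemma quot_class_one: "quot_class P Q 1 = \<one>\<^bsub>quot_ring P Q\<^esub>"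
  using ring_hom_one[OF quot_class_ring_hom, of P Q] by (simp add: ring_of_type_algebra_def)

lemma carrier_quot_ring: "carrier (quot_ring P Q) = range (quot_class P Q)"
  by (auto simp: quot_ring_def quot_class_def FactRing_def A_RCOSETS_def' ring_of_type_algebra_def)

section \<open>Linear representatives modulo \<open>f\<close>\<close>

text \<open>Horner's scheme: multiplying a linear representative by \<open>t\<close> and reducing with
  \<open>t\<^sup>2 = P t - Q\<close> gives a linear representative again.\<close>

lemma quot_class_linear_rep: "\<exists>a. quot_class P Q p = vec_to_quot P Q a"
proof (induction p)
  case 0
  show ?case by (rule exI[of _ 0]) (simp add: vec_to_quot_def)
next
  case (pCons c p)
  then obtain a :: "'a ^ 2" where "char_poly P Q dvd p - [:a $ 1, - (a $ 2):]"
    by (auto simp: vec_to_quot_def quot_class_eq_iff)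
  then obtain k where k: "p - [:a $ 1, - (a $ 2):] = char_poly P Q * k"
    by (auto elim: dvdE)
  \<comment> \<open>The new coordinates come from \<open>c + t (a1 - a0 t)\<close>, where
    subtracting \<open>- a0\<close> times \<open>f\<close> removes the quadratic term.\<close>
  have "pCons c p - [:c + Q * a $ 2, - (P * a $ 2 - a $ 1):] =
      pCons 0 (p - [:a $ 1, - (a $ 2):]) - smult (a $ 2) (char_poly P Q)"
    by (simp add: char_poly_def algebra_simps)
  also have "\<dots> = char_poly P Q * (pCons 0 k - [:a $ 2:])"
    by (simp add: k algebra_simps)
  finally have "char_poly P Q dvd pCons c p - [:c + Q * a $ 2, - (P * a $ 2 - a $ 1):]"
    by (rule dvdI)
  then have "quot_class P Q (pCons c p) = vec_to_quot P Q (vector [c + Q * a $ 2, P * a $ 2 - a $ 1])"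
    by (simp add: vec_to_quot_def quot_class_eq_iff)
  then show ?case by blast
qed

text \<open>Two linear representatives differ by a polynomial of degree at most 1, which the
  quadratic \<open>f\<close> divides only if it is zero.\<close>

lemma vec_to_quot_inj:
  assumes "vec_to_quot P Q a = vec_to_quot P Q b"
  shows "a = b"
proof -
  let ?d = "[:a $ 1, - (a $ 2):] - [:b $ 1, - (b $ 2):]"
  have "char_poly P Q dvd ?d"
    using assms by (simp add: vec_to_quot_def quot_class_eq_iff)
  moreover have "degree ?d < degree (char_poly P Q)"
    by (simp add: char_poly_def)
  ultimately have "?d = 0"
    by (meson dvd_imp_degree_le not_le)
  then show ?thesis
    by (simp add: vec_eq_iff forall_2)
qed

lemma vec_to_quot_mult:
  "vec_to_quot P Q a \<otimes>\<^bsub>quot_ring P Q\<^esub> vec_to_quot P Q b = vec_to_quot P Q (vec_mult P Q a b)"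
proof -
  \<comment> \<open>The product has leading coefficient \<open>a0 b0\<close>, so that constant is
    the quotient on division by the monic \<open>f\<close>.\<close>
  have "[:a $ 1, - (a $ 2):] * [:b $ 1, - (b $ 2):] -
      [:vec_mult P Q a b $ 1, - (vec_mult P Q a b $ 2):] = char_poly P Q * [:a $ 2 * b $ 2:]"
    by (simp add: vec_mult_def char_poly_def algebra_simps)
  then show ?thesis
    by (simp add: vec_to_quot_def quot_class_mult quot_class_eq_iff del: mult_pCons_left mult_pCons_right)
qed

lemma vec_to_quot_one: "vec_to_quot P Q (vector [1, 0]) = \<one>\<^bsub>quot_ring P Q\<^esub>"
  by (simp add: vec_to_quot_def flip: quot_class_one one_pCons)

lemma vec_to_quot_closed: "vec_to_quot P Q a \<in> carrier (quot_ring P Q)"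
  by (auto simp: carrier_quot_ring vec_to_quot_def)

text \<open>\<open>\<Lambda>\<close> is the norm form: \<open>(a\<^sub>1 - a\<^sub>0 t) (a\<^sub>1 - a\<^sub>0 (P - t)) = \<Lambda>(a\<^sub>1, a\<^sub>0)\<close> modulo \<open>f\<close>.\<close>

lemma vec_to_quot_unit_iff:
  "vec_to_quot P Q a \<in> Units (quot_ring P Q) \<longleftrightarrow> a \<in> vec_units P Q"
proof
  interpret O: cring "quot_ring P Q" by (rule cring_quot_ring)
  assume "vec_to_quot P Q a \<in> Units (quot_ring P Q)"
  then obtain y where "y \<in> carrier (quot_ring P Q)"
    and y: "vec_to_quot P Q a \<otimes>\<^bsub>quot_ring P Q\<^esub> y = \<one>\<^bsub>quot_ring P Q\<^esub>"
    by (auto simp: Units_def)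
  then obtain b where "y = vec_to_quot P Q b"
    using quot_class_linear_rep by (metis carrier_quot_ring imageE)
  with y have "vec_mult P Q a b = vector [1, 0]"
    by (intro vec_to_quot_inj) (simp add: vec_to_quot_mult vec_to_quot_one)
  \<comment> \<open>Taking norms turns an inverse of the class into an inverse of \<Lambda>.\<close>
  then have "Lam P Q (a $ 1) (a $ 2) * Lam P Q (b $ 1) (b $ 2) = 1"
    by (simp flip: Lam_vec_mult) (simp add: Lam_def)
  then show "a \<in> vec_units P Q"
    unfolding vec_units_def by (metis dvd_triv_left mem_Collect_eq)
next
  interpret O: cring "quot_ring P Q" by (rule cring_quot_ring)
  assume "a \<in> vec_units P Q"
  then obtain k where k: "Lam P Q (a $ 1) (a $ 2) * k = 1"
    unfolding vec_units_def by (metis dvdE mem_Collect_eq)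
  \<comment> \<open>The conjugate \<open>a1 - a0 (P - t)\<close> in coordinates, divided by the norm
    through \<open>k\<close>.\<close>
  define b :: "'a ^ 2" where "b = vector [(a $ 1 - P * a $ 2) * k, - (a $ 2 * k)]"
  have "vec_mult P Q a b = vector [Lam P Q (a $ 1) (a $ 2) * k, 0]"
    by (simp add: vec_mult_def b_def Lam_def vec_eq_iff forall_2 algebra_simps power2_eq_square)
  then have "vec_to_quot P Q a \<otimes>\<^bsub>quot_ring P Q\<^esub> vec_to_quot P Q b = \<one>\<^bsub>quot_ring P Q\<^esub>"
    by (simp add: vec_to_quot_mult k vec_to_quot_one)
  then show "vec_to_quot P Q a \<in> Units (quot_ring P Q)"
    using vec_to_quot_closed O.m_comm[OF vec_to_quot_closed vec_to_quot_closed, of a b]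
    unfolding Units_def by auto
qed

lemma bij_betw_vec_to_quot: "bij_betw (vec_to_quot P Q) (vec_units P Q) (Units (quot_ring P Q))"
proof (rule bij_betw_imageI)
  show "inj_on (vec_to_quot P Q) (vec_units P Q)"
    by (auto intro: inj_onI vec_to_quot_inj)
  have "Units (quot_ring P Q) \<subseteq> range (vec_to_quot P Q)"
    using quot_class_linear_rep[of P Q] by (force simp: Units_def carrier_quot_ring)
  then show "vec_to_quot P Q ` vec_units P Q = Units (quot_ring P Q)"
    using vec_to_quot_unit_iff by blast
qed

text \<open>\<open>P - t\<close> has coordinates \<open>(P, 1)\<close>, and \<open>vec_mult\<close>
  by this vector is the companion matrix.\<close>

lemma vec_to_quot_Bmat:
  "vec_to_quot P Q (Bmat P Q *v a) = quot_class P Q [:P, - 1:] \<otimes>\<^bsub>quot_ring P Q\<^esub> vec_to_quot P Q a"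
proof -
  have "quot_class P Q [:P, - 1:] = vec_to_quot P Q (vector [P, 1])"
    by (simp add: vec_to_quot_def)
  moreover have "vec_mult P Q (vector [P, 1]) a = Bmat P Q *v a"
    by (simp add: vec_mult_def Bmat_mult_vec)
  ultimately show ?thesis
    by (simp add: vec_to_quot_mult)
qed

text \<open>The norm of \<open>P - t\<close> is \<open>Q\<close>.\<close>

lemma quot_class_companion_unit:
  assumes "Q dvd 1"
  shows "quot_class P Q [:P, - 1:] \<in> Units (quot_ring P Q)"
proof -
  have "vector [P, 1] \<in> vec_units P Q"
    using assms by (simp add: vec_units_def Lam_def power2_eq_square)
  then show ?thesis
    by (simp add: vec_to_quot_def flip: vec_to_quot_unit_iff)
qed

lemma vec_to_quot_Bmat_int_pow:
  assumes "Q dvd 1" and "a \<in> vec_units P Q"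
  shows "vec_to_quot P Q ((Bmat P Q [^]\<^bsub>GL2\<^esub> (n :: int)) *v a) =
    (quot_class P Q [:P, - 1:] [^]\<^bsub>quot_units P Q\<^esub> n) \<otimes>\<^bsub>quot_units P Q\<^esub> vec_to_quot P Q a"
proof -
  interpret O: group "quot_units P Q" by (rule group_quot_units)
  let ?c = "quot_class P Q [:P, - 1:]"
  define q where "q n = vec_to_quot P Q ((Bmat P Q [^]\<^bsub>GL2\<^esub> n) *v a)" for n :: int
  have c: "?c \<in> carrier (quot_units P Q)"
    using quot_class_companion_unit[OF assms(1)] by (simp add: quot_units_def units_of_carrier)
  have q: "q n \<in> carrier (quot_units P Q)" for n
    using Bmat_int_pow_mult_vec_units[OF assms]
    by (simp add: q_def quot_units_def units_of_carrier vec_to_quot_unit_iff)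
  have step: "q (n + 1) = ?c \<otimes>\<^bsub>quot_units P Q\<^esub> q n" for n
    by (simp add: q_def Bmat_int_pow_add_1[OF assms(1)] vec_to_quot_Bmat quot_units_def units_of_mult)
  have pow: "?c [^]\<^bsub>quot_units P Q\<^esub> (n + 1) = ?c \<otimes>\<^bsub>quot_units P Q\<^esub> ?c [^]\<^bsub>quot_units P Q\<^esub> n"
    for n :: int
    using O.int_pow_mult[OF c, of 1 n] by (simp add: O.int_pow_1 c add.commute)
  have "q n = (?c [^]\<^bsub>quot_units P Q\<^esub> n) \<otimes>\<^bsub>quot_units P Q\<^esub> q 0"
  proof (induction n rule: int_induct[where k = 0])
    case base
    show ?case using q by simp
  next
    case (step1 i)
    then show ?case using c q by (simp add: step pow O.m_assoc)
  next
    case (step2 i)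
    \<comment> \<open>Downward step: both sides equal \<open>q i\<close>, and the unit
      \<open>?c\<close> cancels in the group.\<close>
    have "?c \<otimes>\<^bsub>quot_units P Q\<^esub> q (i - 1) = ?c \<otimes>\<^bsub>quot_units P Q\<^esub>
        ((?c [^]\<^bsub>quot_units P Q\<^esub> (i - 1)) \<otimes>\<^bsub>quot_units P Q\<^esub> q 0)"
      using step2 step[of "i - 1"] pow[of "i - 1"] c q by (simp add: O.m_assoc)
    then show ?case using c q by simp
  qed
  then show ?thesis by (simp add: q_def GL2_one_mult_vec)
qed

section \<open>Laxton's product\<close>

lemma emb_simps [simp]:
  "emb 0 = 0" "emb 1 = 1" "emb (x + y) = emb x + emb y" "emb (x - y) = emb x - emb y"
  "emb (- x) = - emb x" "emb (x * y) = emb x * emb y" "emb x = emb y \<longleftrightarrow> x = y"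
  by (simp_all add: emb_def)

text \<open>Giving the roots as a factorization makes their sum and product available by comparing
  coefficients.\<close>

locale laxton =
  fixes P Q :: "'a::idom" and \<theta>1 \<theta>2 :: "'a fract alg_closure"
  assumes Q_unit: "Q dvd 1"
    and disc: "P^2 - 4 * Q \<noteq> 0"
    and roots: "map_poly emb (char_poly P Q) = [:- \<theta>1, 1:] * [:- \<theta>2, 1:]"
begin

section \<open>The roots and Binet's formula\<close>

lemma emb_P: "emb P = \<theta>1 + \<theta>2" and emb_Q: "emb Q = \<theta>1 * \<theta>2"
proof -
  have "map_poly emb (char_poly P Q) = [:emb Q, - emb P, 1:]"
    by (simp add: char_poly_def map_poly_pCons)
  then have "- \<theta>2 - \<theta>1 = - emb P" "\<theta>2 * \<theta>1 = emb Q"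
    using roots by simp_all
  then have "emb P = - (- \<theta>2 - \<theta>1)" "\<theta>2 * \<theta>1 = emb Q"
    by (simp_all only: minus_minus)
  then show "emb P = \<theta>1 + \<theta>2" "emb Q = \<theta>1 * \<theta>2"
    by (simp_all add: mult.commute)
qed

lemma theta_distinct: "\<theta>1 \<noteq> \<theta>2"
proof
  assume "\<theta>1 = \<theta>2"
  \<comment> \<open>For equal roots the discriminant, the square of their difference, vanishes. It
    is written with sums and products only so that \<open>emb_simps\<close> applies.\<close>
  then have "emb (P * P - (Q + Q + Q + Q)) = 0"
    unfolding emb_simps emb_P emb_Q by (simp add: algebra_simps)
  then have "emb (P * P - (Q + Q + Q + Q)) = emb 0"
    by simp
  then have "P * P - (Q + Q + Q + Q) = 0"
    by (simp only: emb_simps(7))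
  with disc show False
    by (simp add: power2_eq_square)
qed

lemma Q_nonzero: "Q \<noteq> 0"
  using Q_unit by auto

text \<open>The product of the roots is \<open>Q\<close>. Nonzero roots give the exponent law for
  \<open>powi\<close> at negative exponents.\<close>

lemma theta_nonzero: "\<theta>1 \<noteq> 0" "\<theta>2 \<noteq> 0"
proof -
  have "emb Q \<noteq> emb 0"
    using Q_nonzero by (simp only: emb_simps(7) not_False_eq_True)
  then show "\<theta>1 \<noteq> 0" "\<theta>2 \<noteq> 0"
    by (auto simp: emb_Q)
qed

text \<open>Powers of a root satisfy the recurrence because the root is a zero of \<open>f\<close>;
  the Binet expression is a linear combination of them.\<close>

lemma recurrent_binet: "recurrent (emb P) (emb Q) (binet \<theta>1 \<theta>2 A B)"
proof -
  have *: "\<theta> powi (n + 2) = emb P * \<theta> powi (n + 1) - emb Q * \<theta> powi n" if "\<theta> = \<theta>1 \<or> \<theta> = \<theta>2" for \<theta> n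
    using that theta_nonzero
    by (auto simp: emb_P emb_Q power_int_add algebra_simps power2_eq_square)
  show ?thesis
    by (simp add: recurrent_iff binet_def *[of \<theta>1] *[of \<theta>2] right_diff_distrib
        diff_divide_distrib mult.left_commute)
qed

text \<open>Both sides are recurrent over the closure and agree at 0 and 1, where the numerators are
  \<open>w 0\<close> and \<open>w 1\<close> times the difference of the roots.\<close>

lemma binet_formula:
  assumes "recurrent P Q w"
  shows "emb (w n) = binet \<theta>1 \<theta>2 (binet_coeff \<theta>2 w) (binet_coeff \<theta>1 w) n"
proof -
  have "recurrent (emb P) (emb Q) (\<lambda>n. emb (w n))"
    using assms unfolding recurrent_def by (metis emb_simps(1,3,4,6))
  moreover have "emb Q \<noteq> 0"
    by (simp add: emb_Q theta_nonzero)
  ultimately have "(\<lambda>n. emb (w n)) = binet \<theta>1 \<theta>2 (binet_coeff \<theta>2 w) (binet_coeff \<theta>1 w)"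
    by (intro recurrent_eqI[OF _ recurrent_binet])
      (use theta_distinct in \<open>simp_all add: binet_def binet_coeff_def field_simps\<close>)
  then show ?thesis by (rule fun_cong)
qed

text \<open>\<open>binet_coeff \<theta>\<close> evaluates \<open>w1 - w0 t\<close> at
  \<open>t = \<theta>\<close>, which respects multiplication modulo \<open>f\<close> as \<theta> is
  a root.\<close>

lemma binet_coeff_vec_mult:
  assumes "seq_to_vec u = vec_mult P Q (seq_to_vec w) (seq_to_vec v)" and "\<theta> = \<theta>1 \<or> \<theta> = \<theta>2"
  shows "binet_coeff \<theta> u = binet_coeff \<theta> w * binet_coeff \<theta> v"
proof -
  have u: "u 1 = w 1 * v 1 - Q * w 0 * v 0" "u 0 = w 0 * v 1 + w 1 * v 0 - P * w 0 * v 0"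
    using assms(1) by (simp_all add: seq_to_vec_def vec_mult_def vec_eq_iff forall_2)
  show ?thesis
    unfolding binet_coeff_def u emb_simps emb_P emb_Q using assms(2) by (auto simp: algebra_simps)
qed

text \<open>Discharges the definite description: Binet's formula gives existence, injectivity of
  \<open>emb\<close> uniqueness.\<close>

lemma laxton_mult_eqI:
  assumes "recurrent P Q u" and "seq_to_vec u = vec_mult P Q (seq_to_vec w) (seq_to_vec v)"
  shows "laxton_mult \<theta>1 \<theta>2 w v = u"
  unfolding laxton_mult_def
proof (rule the_equality)
  show *: "\<forall>n. emb (u n) = binet \<theta>1 \<theta>2 (binet_coeff \<theta>2 w * binet_coeff \<theta>2 v)
      (binet_coeff \<theta>1 w * binet_coeff \<theta>1 v) n"
    using binet_formula[OF assms(1)] binet_coeff_vec_mult[OF assms(2)] by simp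
  show "u' = u" if "\<forall>n. emb (u' n) = binet \<theta>1 \<theta>2 (binet_coeff \<theta>2 w * binet_coeff \<theta>2 v)
      (binet_coeff \<theta>1 w * binet_coeff \<theta>1 v) n" for u'
    using * that by (metis emb_simps(7) ext)
qed

text \<open>Extending the initial terms given by \<open>vec_mult\<close> shows that the product has
  values in the ring, despite the division by the difference of the roots.\<close>

lemma laxton_mult_recurrent: "recurrent P Q (laxton_mult \<theta>1 \<theta>2 w v)"
  and seq_to_vec_laxton_mult:
    "seq_to_vec (laxton_mult \<theta>1 \<theta>2 w v) = vec_mult P Q (seq_to_vec w) (seq_to_vec v)"
proof -
  obtain u where "recurrent P Q u" "seq_to_vec u = vec_mult P Q (seq_to_vec w) (seq_to_vec v)"
    using recurrent_extension[OF Q_unit] .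
  moreover from this have "laxton_mult \<theta>1 \<theta>2 w v = u"
    by (rule laxton_mult_eqI)
  ultimately show "recurrent P Q (laxton_mult \<theta>1 \<theta>2 w v)"
    "seq_to_vec (laxton_mult \<theta>1 \<theta>2 w v) = vec_mult P Q (seq_to_vec w) (seq_to_vec v)"
    by simp_all
qed

lemma laxton_mult_binet:
  "emb (laxton_mult \<theta>1 \<theta>2 w v n) =
     binet \<theta>1 \<theta>2 (binet_coeff \<theta>2 w * binet_coeff \<theta>2 v) (binet_coeff \<theta>1 w * binet_coeff \<theta>1 v) n"
  by (simp add: binet_formula[OF laxton_mult_recurrent] binet_coeff_vec_mult[OF seq_to_vec_laxton_mult])

text \<open>With initial terms 1 and 0, both Binet coefficients are 1.\<close>

lemma laxton_one_recurrent: "recurrent P Q (laxton_one \<theta>1 \<theta>2)"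
  and seq_to_vec_laxton_one: "seq_to_vec (laxton_one \<theta>1 \<theta>2) = vector [1, 0]"
proof -
  obtain u where u: "recurrent P Q u" "seq_to_vec u = vector [1, 0]"
    using recurrent_extension[OF Q_unit] .
  then have "u 1 = 1" "u 0 = 0"
    by (simp_all add: seq_to_vec_def vec_eq_iff forall_2)
  then have *: "emb (u n) = binet \<theta>1 \<theta>2 1 1 n" for n
    using binet_formula[OF u(1)] by (simp add: binet_coeff_def)
  then have "laxton_one \<theta>1 \<theta>2 = u"
    unfolding laxton_one_def by (intro the_equality) (metis emb_simps(7) ext)+
  with u show "recurrent P Q (laxton_one \<theta>1 \<theta>2)" "seq_to_vec (laxton_one \<theta>1 \<theta>2) = vector [1, 0]"
    by simp_all
qed

section \<open>Laxton's group and the transported structures\<close>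

lemma laxton_mult_closed:
  assumes "w \<in> seq_units P Q" "v \<in> seq_units P Q"
  shows "laxton_mult \<theta>1 \<theta>2 w v \<in> seq_units P Q"
  using assms by (simp add: seq_units_iff laxton_mult_recurrent seq_to_vec_laxton_mult vec_mult_closed)

lemma laxton_one_closed: "laxton_one \<theta>1 \<theta>2 \<in> seq_units P Q"
  by (simp add: seq_units_iff laxton_one_recurrent seq_to_vec_laxton_one one_in_vec_units)

lemma bij_betw_seq_to_quot:
  "bij_betw (vec_to_quot P Q \<circ> seq_to_vec) (seq_units P Q) (Units (quot_ring P Q))"
  by (rule bij_betw_trans[OF bij_betw_seq_to_vec[OF Q_unit] bij_betw_vec_to_quot])

text \<open>The Laxton product lies in \<open>seq_units P Q\<close> and maps to the product of the
  two classes, so \<open>inv_into\<close> recovers it.\<close>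

lemma laxton_mult_transported:
  assumes "w \<in> seq_units P Q" "v \<in> seq_units P Q"
  shows "laxton_mult \<theta>1 \<theta>2 w v =
    w \<otimes>\<^bsub>transport (seq_units P Q) (vec_to_quot P Q \<circ> seq_to_vec) (quot_units P Q)\<^esub> v"
  using bij_betw_inv_into_left[OF bij_betw_seq_to_quot laxton_mult_closed[OF assms]]
  by (simp add: transport_def quot_units_def units_of_mult vec_to_quot_mult seq_to_vec_laxton_mult)

lemma laxton_one_transported:
  "laxton_one \<theta>1 \<theta>2 = \<one>\<^bsub>transport (seq_units P Q) (vec_to_quot P Q \<circ> seq_to_vec) (quot_units P Q)\<^esub>"
  using bij_betw_inv_into_left[OF bij_betw_seq_to_quot laxton_one_closed]
  by (simp add: transport_def quot_units_def units_of_one vec_to_quot_one seq_to_vec_laxton_one)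

lemma vec_group_mult:
  assumes "a \<in> vec_units P Q" "b \<in> vec_units P Q"
  shows "a \<otimes>\<^bsub>vec_group P Q\<^esub> b = vec_mult P Q a b"
  using bij_betw_inv_into_left[OF bij_betw_vec_to_quot vec_mult_closed[OF assms]]
  by (simp add: vec_group_def transport_def quot_units_def units_of_mult vec_to_quot_mult)

lemma group_laxton_group: "group (laxton_group P Q \<theta>1 \<theta>2)"
proof (rule group_if_bij_hom[OF group_quot_units])
  show "bij_betw (vec_to_quot P Q \<circ> seq_to_vec) (carrier (laxton_group P Q \<theta>1 \<theta>2))
      (carrier (quot_units P Q))"
    using bij_betw_seq_to_quot by (simp add: laxton_group_def quot_units_def units_of_carrier)
qed (simp_all add: laxton_group_def laxton_mult_closed laxton_one_closed quot_units_def units_of_mult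
  units_of_one vec_to_quot_mult vec_to_quot_one seq_to_vec_laxton_mult seq_to_vec_laxton_one)

lemma seq_to_vec_iso: "seq_to_vec \<in> iso (laxton_group P Q \<theta>1 \<theta>2) (vec_group P Q)"
  using bij_betw_seq_to_vec[OF Q_unit, of P]
  by (auto simp: iso_def hom_def laxton_group_def vec_group_mult seq_to_vec_laxton_mult seq_units_iff)
    (simp_all add: vec_group_def transport_def)

lemma vec_to_quot_iso: "vec_to_quot P Q \<in> iso (vec_group P Q) (quot_units P Q)"
proof -
  have "carrier (vec_group P Q) = vec_units P Q"
    by (simp add: vec_group_def transport_def)
  then show ?thesis
    using bij_betw_vec_to_quot[of P Q]
    by (auto simp: iso_def hom_def vec_group_mult quot_units_def units_of_carrier units_of_mult
        vec_to_quot_mult vec_to_quot_unit_iff)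
qed

text \<open>The matrix action is carried to sequences and to units along the bijections, so
  compatibility is built in and only the formulas for powers remain. The actions are defined on
  matrices, not exponents, so a matrix of finite order raises no question of
  well-definedness.\<close>

lemma companion_actions:
  "\<exists>actS actV actO.
        group_action (Bgroup P Q) (seq_units P Q) actS \<and>
        group_action (Bgroup P Q) (vec_units P Q) actV \<and>
        group_action (Bgroup P Q) (Units (quot_ring P Q)) actO \<and>
        (\<forall>\<nu>::int. \<forall>w\<in>seq_units P Q.
           actS (Bmat P Q [^]\<^bsub>GL2\<^esub> \<nu>) w = (\<lambda>n. w (n + \<nu>))) \<and>
        (\<forall>\<nu>::int. \<forall>a\<in>vec_units P Q.
           actV (Bmat P Q [^]\<^bsub>GL2\<^esub> \<nu>) a = (Bmat P Q [^]\<^bsub>GL2\<^esub> \<nu>) *v a) \<and>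
        (\<forall>\<nu>::int. \<forall>a\<in>vec_units P Q.
           actO (Bmat P Q [^]\<^bsub>GL2\<^esub> \<nu>) (vec_to_quot P Q a) =
             (quot_class P Q [:P, - 1:] [^]\<^bsub>quot_units P Q\<^esub> \<nu>) \<otimes>\<^bsub>quot_ring P Q\<^esub> vec_to_quot P Q a) \<and>
        (\<forall>g\<in>carrier (Bgroup P Q). \<forall>w\<in>seq_units P Q.
           seq_to_vec (actS g w) = actV g (seq_to_vec w)) \<and>
        (\<forall>g\<in>carrier (Bgroup P Q). \<forall>a\<in>vec_units P Q.
           vec_to_quot P Q (actV g a) = actO g (vec_to_quot P Q a))"
proof -
  let ?V = "vec_units P Q" and ?S = "seq_units P Q" and ?O = "Units (quot_ring P Q)"
  \<comment> \<open>Transport pulls an action back along a map into \<open>?V\<close>, so the units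
    need the inverse of \<open>vec_to_quot P Q\<close>.\<close>
  let ?h = "inv_into ?V (vec_to_quot P Q)"
  let ?actV = "\<lambda>g. \<lambda>a\<in>?V. g *v a"
  let ?actS = "\<lambda>g. \<lambda>w\<in>?S. inv_into ?S seq_to_vec (?actV g (seq_to_vec w))"
  let ?actO = "\<lambda>g. \<lambda>x\<in>?O. inv_into ?O ?h (?actV g (?h x))"
  note bijS = bij_betw_seq_to_vec[OF Q_unit, of P]
  note bijO = bij_betw_inv_into[OF bij_betw_vec_to_quot[of P Q]]
  have V: "group_action (Bgroup P Q) ?V ?actV"
    by (rule group_action_vec_units[OF Q_unit])
  have closed: "?actV g a \<in> ?V" if "g \<in> carrier (Bgroup P Q)" "a \<in> ?V" for g a
    using group_action.element_image[OF V that] by blast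
  have seq_in: "seq_to_vec w \<in> ?V" if "w \<in> ?S" for w
    using that by (simp add: seq_units_iff)
  have S_compat: "seq_to_vec (?actS g w) = ?actV g (seq_to_vec w)"
    if "g \<in> carrier (Bgroup P Q)" "w \<in> ?S" for g w
    using bij_betw_inv_into_right[OF bijS closed[OF that(1) seq_in[OF that(2)]]] that(2) by simp
  have h: "?h (vec_to_quot P Q a) = a" if "a \<in> ?V" for a
    using that by (rule bij_betw_inv_into_left[OF bij_betw_vec_to_quot])
  have h': "inv_into ?O ?h a = vec_to_quot P Q a" if "a \<in> ?V" for a
    using bij_betw_inv_into_left[OF bijO, of "vec_to_quot P Q a"] that h
    by (simp add: vec_to_quot_unit_iff)
  have O_compat: "vec_to_quot P Q (?actV g a) = ?actO g (vec_to_quot P Q a)"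
    if "g \<in> carrier (Bgroup P Q)" "a \<in> ?V" for g a
    using closed[OF that] that(2) by (simp add: vec_to_quot_unit_iff h h')
  have B: "Bmat P Q [^]\<^bsub>GL2\<^esub> n \<in> carrier (Bgroup P Q)" for n :: int
    by (simp add: carrier_Bgroup[OF Q_unit])
  have S_shift: "?actS (Bmat P Q [^]\<^bsub>GL2\<^esub> n) w = (\<lambda>k. w (k + n))" if "w \<in> ?S" for n :: int and w
  proof -
    \<comment> \<open>The shifted sequence again lies in \<open>?S\<close>, so it is determined by
      its initial vector.\<close>
    have "?actV (Bmat P Q [^]\<^bsub>GL2\<^esub> n) (seq_to_vec w) = seq_to_vec (\<lambda>k. w (k + n))"
      using that seq_to_vec_shift[OF Q_unit, of P w n] by (simp add: seq_units_iff)
    then show ?thesis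
      using bij_betw_inv_into_left[OF bijS seq_units_shift[OF Q_unit that]] that by simp
  qed
  have O_pow: "?actO (Bmat P Q [^]\<^bsub>GL2\<^esub> n) (vec_to_quot P Q a) =
      (quot_class P Q [:P, - 1:] [^]\<^bsub>quot_units P Q\<^esub> n) \<otimes>\<^bsub>quot_ring P Q\<^esub> vec_to_quot P Q a"
    if "a \<in> ?V" for n :: int and a
    using O_compat[OF B that, of n] vec_to_quot_Bmat_int_pow[OF Q_unit that, of n] that
    by (simp add: quot_units_def units_of_mult)
  have V_pow: "?actV (Bmat P Q [^]\<^bsub>GL2\<^esub> n) a = (Bmat P Q [^]\<^bsub>GL2\<^esub> n) *v a"
    if "a \<in> ?V" for n :: int and a
    using that by simp
  show ?thesis
    by (intro exI[of _ ?actS] exI[of _ ?actV] exI[of _ ?actO] conjI ballI allI)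
      (rule V group_action_transport[OF V bijS] group_action_transport[OF V bijO]
        S_compat O_compat S_shift V_pow O_pow; assumption)+
qed

end

theorem theorem3:
  fixes P Q :: "'a::idom" and \<theta>1 \<theta>2 :: "'a fract alg_closure"
  assumes "Q dvd 1"
    and "P^2 - 4 * Q \<noteq> 0"
    and "map_poly emb (char_poly P Q) = [:- \<theta>1, 1:] * [:- \<theta>2, 1:]"
  shows
    \<comment> \<open>Laxton's product is well defined\<close>
    "(\<forall>w\<in>seq_units P Q. \<forall>n.
        emb (w n) = binet \<theta>1 \<theta>2 (binet_coeff \<theta>2 w) (binet_coeff \<theta>1 w) n) \<and>
     (\<forall>w\<in>seq_units P Q. \<forall>v\<in>seq_units P Q. \<forall>n.
        emb (laxton_mult \<theta>1 \<theta>2 w v n) =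
          binet \<theta>1 \<theta>2 (binet_coeff \<theta>2 w * binet_coeff \<theta>2 v)
                      (binet_coeff \<theta>1 w * binet_coeff \<theta>1 v) n) \<and>
     group (laxton_group P Q \<theta>1 \<theta>2) \<and>
     \<comment> \<open>the two maps are bijections\<close>
     bij_betw seq_to_vec (seq_units P Q) (vec_units P Q) \<and>
     bij_betw (vec_to_quot P Q) (vec_units P Q) (Units (quot_ring P Q)) \<and>
     \<comment> \<open>Laxton's group structure is the transported one\<close>
     (let T = transport (seq_units P Q) (vec_to_quot P Q \<circ> seq_to_vec) (quot_units P Q) in
        (\<forall>w\<in>seq_units P Q. \<forall>v\<in>seq_units P Q.
           w \<otimes>\<^bsub>laxton_group P Q \<theta>1 \<theta>2\<^esub> v = w \<otimes>\<^bsub>T\<^esub> v) \<and>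
        \<one>\<^bsub>laxton_group P Q \<theta>1 \<theta>2\<^esub> = \<one>\<^bsub>T\<^esub>) \<and>
     seq_to_vec \<in> iso (laxton_group P Q \<theta>1 \<theta>2) (vec_group P Q) \<and>
     vec_to_quot P Q \<in> iso (vec_group P Q) (quot_units P Q) \<and>
     \<comment> \<open>the actions of the group generated by the companion matrix\<close>
     Bmat P Q \<in> carrier GL2 \<and>
     quot_class P Q [:P, - 1:] \<in> Units (quot_ring P Q) \<and>
     (\<exists>actS actV actO.
        group_action (Bgroup P Q) (seq_units P Q) actS \<and>
        group_action (Bgroup P Q) (vec_units P Q) actV \<and>
        group_action (Bgroup P Q) (Units (quot_ring P Q)) actO \<and>
        (\<forall>\<nu>::int. \<forall>w\<in>seq_units P Q.
           actS (Bmat P Q [^]\<^bsub>GL2\<^esub> \<nu>) w = (\<lambda>n. w (n + \<nu>))) \<and>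
        (\<forall>\<nu>::int. \<forall>a\<in>vec_units P Q.
           actV (Bmat P Q [^]\<^bsub>GL2\<^esub> \<nu>) a = (Bmat P Q [^]\<^bsub>GL2\<^esub> \<nu>) *v a) \<and>
        (\<forall>\<nu>::int. \<forall>a\<in>vec_units P Q.
           actO (Bmat P Q [^]\<^bsub>GL2\<^esub> \<nu>) (vec_to_quot P Q a) =
             (quot_class P Q [:P, - 1:] [^]\<^bsub>quot_units P Q\<^esub> \<nu>) \<otimes>\<^bsub>quot_ring P Q\<^esub> vec_to_quot P Q a) \<and>
        (\<forall>g\<in>carrier (Bgroup P Q). \<forall>w\<in>seq_units P Q.
           seq_to_vec (actS g w) = actV g (seq_to_vec w)) \<and>
        (\<forall>g\<in>carrier (Bgroup P Q). \<forall>a\<in>vec_units P Q.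
           vec_to_quot P Q (actV g a) = actO g (vec_to_quot P Q a)))"
proof -
  interpret laxton P Q \<theta>1 \<theta>2
    using assms by unfold_locales
  have mult: "w \<otimes>\<^bsub>laxton_group P Q \<theta>1 \<theta>2\<^esub> v = laxton_mult \<theta>1 \<theta>2 w v" for w v
    by (simp add: laxton_group_def)
  have one: "\<one>\<^bsub>laxton_group P Q \<theta>1 \<theta>2\<^esub> = laxton_one \<theta>1 \<theta>2"
    by (simp add: laxton_group_def)
  show ?thesis
    unfolding Let_def mult one
    by (intro conjI ballI allI companion_actions group_laxton_group seq_to_vec_iso vec_to_quot_iso
        bij_betw_seq_to_vec bij_betw_vec_to_quot laxton_mult_transported laxton_one_transported
        Bmat_in_GL2 quot_class_companion_unit laxton_mult_binet binet_formula Q_unit)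
      (auto simp: seq_units_iff)
qed

end
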